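(* Let $\Gamma$ be a finite simplicial graph with vertex set $V$, $|V|=n$, that is link-regular and contains no $4$-cliques. Suppose $\Gamma$ is $l$-regular and let $q$ be the link-number of an edge, i.e. $|\mathrm{Lk}(\{u,v\})|=q$ for every edge $\{u,v\}$ of $\Gamma$. Let $C_\Gamma$ be the right-angled Coxeter group based on $\Gamma$, with standard generating set $V$. Then its geodesic growth series satisfies $$\mathcal{G}_{(C_\Gamma, V)}(z)-1=\frac{nz\left(1 + (5 - l - q)z + (lq - 3l + 6)z^2\right)}{1 + (6-n-l-q)z + (nl + lq + qn - 5n - 3l - q + 11)z^2 + (3nl + 6 - nlq - 6n )z^3}.$$
   Context: A simplicial graph is an undirected graph without loops or multiple edges. A clique in $\Gamma$ is a set $\sigma$ of vertices spanning a complete subgraph; it is a $k$-clique if $|\sigma|=k$. The link of a clique $\sigma$ is $\mathrm{Lk}(\sigma)=\{v\in V\setminus\sigma : \{v\}\cup\sigma \text{ spans a clique}\}$. The graph $\Gamma$ is link-regular if $|\mathrm{Lk}(\sigma_1)|=|\mathrm{Lk}(\sigma_2)|$ for all cliques $\sigma_1,\sigma_2$ with $|\sigma_1|=|\sigma_2|$. For graphs without $4$-cliques this amounts to: there are numbers $l,q$ such that every vertex lies on exactly $l$ edges and every edge is contained in exactly $q$ triangles. The right-angled Coxeter group based on $\Gamma$ (with edge set $E$) is $C_\Gamma=\langle V\mid v^2=1\ \forall v\in V,\ uv=vu\ \forall \{u,v\}\in E\rangle$. For a group $G$ with a finite set $X$ generating it as a monoid, let $\pi\colon X^*\to G$ be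 the canonical surjective monoid morphism from the free monoid on $X$, and let $\ell(w)$ be the length of a word $w\in X^*$. A word $w$ is a geodesic if $\ell(w)=\min\{\ell(u): u\in X^*,\ \pi(u)=\pi(w)\}$. The geodesic growth series of $(G,X)$ is $\mathcal{G}_{(G,X)}(z)=\sum_{i\ge 0} g_i z^i\in\mathbb{Z}[[z]]$, where $g_i$ is the number of geodesic words of length $i$ in $X^*$. *)

theory Defs
  imports "HOL-Algebra.Group" "HOL-Computational_Algebra.Formal_Power_Series"
begin

section \<open>Simplicial graphs\<close>

text \<open>A graph is given by its vertex set and its set of edges, each edge being the
  (two-element) set of its end points.\<close>

definition simplicial_graph :: "'a set \<Rightarrow> 'a set set \<Rightarrow> bool" where
  "simplicial_graph V E \<longleftrightarrow> (\<forall>e\<in>E. e \<subseteq> V \<and> card e = 2)"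

definition clique :: "'a set \<Rightarrow> 'a set set \<Rightarrow> 'a set \<Rightarrow> bool" where
  "clique V E \<sigma> \<longleftrightarrow> \<sigma> \<subseteq> V \<and> (\<forall>u\<in>\<sigma>. \<forall>v\<in>\<sigma>. u \<noteq> v \<longrightarrow> {u, v} \<in> E)"

definition link :: "'a set \<Rightarrow> 'a set set \<Rightarrow> 'a set \<Rightarrow> 'a set" where
  "link V E \<sigma> = {v \<in> V - \<sigma>. clique V E (insert v \<sigma>)}"

definition link_regular :: "'a set \<Rightarrow> 'a set set \<Rightarrow> bool" where
  "link_regular V E \<longleftrightarrow>
     (\<forall>\<sigma> \<tau>. clique V E \<sigma> \<and> clique V E \<tau> \<and> card \<sigma> = card \<tau> \<longrightarrow>
        card (link V E \<sigma>) = card (link V E \<tau>))"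

definition regular_graph :: "'a set \<Rightarrow> 'a set set \<Rightarrow> nat \<Rightarrow> bool" where
  "regular_graph V E l \<longleftrightarrow> (\<forall>v\<in>V. card {e \<in> E. v \<in> e} = l)"


section \<open>Group presentations\<close>

text \<open>The letter \<open>(x, True)\<close> stands for the generator \<open>x\<close>, the letter
  \<open>(x, False)\<close> for its formal inverse.\<close>

type_synonym 'a gword = "('a \<times> bool) list"

definition gwords :: "'a set \<Rightarrow> 'a gword set" where
  "gwords X = lists (X \<times> UNIV)"

text \<open>The congruence on signed words over \<open>X\<close> generated by free cancellation and by the
  defining equations \<open>r = s\<close> for \<open>(r, s) \<in> R\<close>.\<close>

inductive_set pres_rel :: "'a set \<Rightarrow> ('a gword \<times> 'a gword) set \<Rightarrow> ('a gword \<times> 'a gword) set"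
  for X R where
  refl: "w \<in> gwords X \<Longrightarrow> (w, w) \<in> pres_rel X R"
| sym: "(v, w) \<in> pres_rel X R \<Longrightarrow> (w, v) \<in> pres_rel X R"
| trans: "(u, v) \<in> pres_rel X R \<Longrightarrow> (v, w) \<in> pres_rel X R \<Longrightarrow> (u, w) \<in> pres_rel X R"
| cancel: "u \<in> gwords X \<Longrightarrow> v \<in> gwords X \<Longrightarrow> x \<in> X \<Longrightarrow>
    (u @ [(x, b), (x, \<not> b)] @ v, u @ v) \<in> pres_rel X R"
| rel: "u \<in> gwords X \<Longrightarrow> v \<in> gwords X \<Longrightarrow> r \<in> gwords X \<Longrightarrow> s \<in> gwords X \<Longrightarrow>
    (r, s) \<in> R \<Longrightarrow> (u @ r @ v, u @ s @ v) \<in> pres_rel X R"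

definition presented_group ::
    "'a set \<Rightarrow> ('a gword \<times> 'a gword) set \<Rightarrow> 'a gword set monoid" where
  "presented_group X R =
     \<lparr>carrier = gwords X // pres_rel X R,
      monoid.mult = (\<lambda>A B. \<Union>a\<in>A. \<Union>b\<in>B. pres_rel X R `` {a @ b}),
      one = pres_rel X R `` {[]}\<rparr>"

definition pres_gen :: "'a set \<Rightarrow> ('a gword \<times> 'a gword) set \<Rightarrow> 'a \<Rightarrow> 'a gword set" where
  "pres_gen X R x = pres_rel X R `` {[(x, True)]}"


section \<open>Right-angled Coxeter groups\<close>

definition racg_relations :: "'a set \<Rightarrow> 'a set set \<Rightarrow> ('a gword \<times> 'a gword) set" where
  "racg_relations V E =
     {([(v, True), (v, True)], []) | v. v \<in> V} \<union>
     {([(u, True), (v, True)], [(v, True), (u, True)]) | u v. {u, v} \<in> E}"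

definition racg :: "'a set \<Rightarrow> 'a set set \<Rightarrow> 'a gword set monoid" where
  "racg V E = presented_group V (racg_relations V E)"

text \<open>The standard generating set is the image of \<open>V\<close> in the group.\<close>

definition racg_gens :: "'a set \<Rightarrow> 'a set set \<Rightarrow> 'a gword set set" where
  "racg_gens V E = pres_gen V (racg_relations V E) ` V"


section \<open>Geodesic growth\<close>

definition word_value :: "('g, 'm) monoid_scheme \<Rightarrow> 'g list \<Rightarrow> 'g" where
  "word_value G w = foldr (\<otimes>\<^bsub>G\<^esub>) w \<one>\<^bsub>G\<^esub>"

definition geodesic :: "('g, 'm) monoid_scheme \<Rightarrow> 'g set \<Rightarrow> 'g list \<Rightarrow> bool" where
  "geodesic G X w \<longleftrightarrow> w \<in> lists X \<and>
     length w = (LEAST k. \<exists>u\<in>lists X. word_value G u = word_value G w \<and> length u = k)"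

definition geodesic_growth_series :: "('g, 'm) monoid_scheme \<Rightarrow> 'g set \<Rightarrow> int fps" where
  "geodesic_growth_series G X = Abs_fps (\<lambda>i. int (card {w. geodesic G X w \<and> length w = i}))"

text \<open>The coefficientwise embedding of integral into rational power series. It is needed because
  the division of power series in the library is not available over the integers.\<close>

definition rat_fps :: "int fps \<Rightarrow> rat fps" where
  "rat_fps f = Abs_fps (\<lambda>i. rat_of_int (fps_nth f i))"


section \<open>Basic facts: the presented groups are groups, generated as intended\<close>

lemma gwords_append [simp]: "u @ v \<in> gwords X \<longleftrightarrow> u \<in> gwords X \<and> v \<in> gwords X"
  by (auto simp: gwords_def)

lemma gwords_Nil [simp]: "[] \<in> gwords X"
  by (simp add: gwords_def)

lemma gwords_Cons [simp]: "(x, b) # v \<in> gwords X \<longleftrightarrow> x \<in> X \<and> v \<in> gwords X"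
  by (auto simp: gwords_def)

lemma pres_rel_gwords: "(u, v) \<in> pres_rel X R \<Longrightarrow> u \<in> gwords X \<and> v \<in> gwords X"
  by (induction rule: pres_rel.induct) auto

lemma equiv_pres_rel: "equiv (gwords X) (pres_rel X R)"
proof (rule equivI)
  show "pres_rel X R \<subseteq> gwords X \<times> gwords X"
    using pres_rel_gwords by fast
  show "refl_on (gwords X) (pres_rel X R)"
    by (rule refl_onI) (rule pres_rel.refl)
  show "Relation.sym (pres_rel X R)"
    by (rule symI) (rule pres_rel.sym)
  show "Relation.trans (pres_rel X R)"
    by (rule transI) (rule pres_rel.trans)
qed

lemma pres_rel_context:
  "(u, v) \<in> pres_rel X R \<Longrightarrow> p \<in> gwords X \<Longrightarrow> q \<in> gwords X \<Longrightarrow>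
     (p @ u @ q, p @ v @ q) \<in> pres_rel X R"
proof (induction rule: pres_rel.induct)
  case (cancel u v x b)
  then show ?case using pres_rel.cancel[of "p @ u" X "v @ q" x b R] by simp
next
  case (rel u v r s)
  then show ?case using pres_rel.rel[of "p @ u" X "v @ q" r s R] by simp
next
  case (refl w)
  then show ?case by (simp add: pres_rel.refl)
next
  case (sym v w)
  then show ?case by (simp add: pres_rel.sym)
next
  case (trans u v w)
  show ?case
    by (rule pres_rel.trans[OF trans.IH(1)[OF trans.prems] trans.IH(2)[OF trans.prems]])
qed

lemma pres_rel_append:
  assumes "(u, u') \<in> pres_rel X R" "(v, v') \<in> pres_rel X R"
  shows "(u @ v, u' @ v') \<in> pres_rel X R"
proof -
  have "(u @ v, u' @ v) \<in> pres_rel X R"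
    using pres_rel_context[OF assms(1), of "[]" v] assms pres_rel_gwords by fastforce
  moreover have "(u' @ v, u' @ v') \<in> pres_rel X R"
    using pres_rel_context[OF assms(2), of u' "[]"] assms pres_rel_gwords by fastforce
  ultimately show ?thesis by (rule pres_rel.trans)
qed

lemma presented_mult:
  assumes "u \<in> gwords X" "v \<in> gwords X"
  shows "pres_rel X R `` {u} \<otimes>\<^bsub>presented_group X R\<^esub> pres_rel X R `` {v}
           = pres_rel X R `` {u @ v}"
proof -
  have *: "pres_rel X R `` {a @ b} = pres_rel X R `` {u @ v}"
    if "(u, a) \<in> pres_rel X R" "(v, b) \<in> pres_rel X R" for a b
    using equiv_class_eq[OF equiv_pres_rel pres_rel_append[OF that]] by simp
  have "(\<Union>a\<in>pres_rel X R `` {u}. \<Union>b\<in>pres_rel X R `` {v}. pres_rel X R `` {a @ b})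
      = (\<Union>a\<in>pres_rel X R `` {u}. \<Union>b\<in>pres_rel X R `` {v}. pres_rel X R `` {u @ v})"
    by (intro SUP_cong refl *) (simp_all only: Image_singleton_iff)
  moreover have "u \<in> pres_rel X R `` {u}" "v \<in> pres_rel X R `` {v}"
    using assms by (simp_all add: pres_rel.refl)
  ultimately show ?thesis
    unfolding presented_group_def monoid.simps by blast
qed

lemma presented_carrierE:
  assumes "A \<in> carrier (presented_group X R)"
  obtains w where "w \<in> gwords X" "A = pres_rel X R `` {w}"
  using assms unfolding presented_group_def by (auto elim: quotientE)

lemma presented_carrierI:
  "w \<in> gwords X \<Longrightarrow> pres_rel X R `` {w} \<in> carrier (presented_group X R)"
  unfolding presented_group_def by (auto intro: quotientI)

lemma presented_one: "\<one>\<^bsub>presented_group X R\<^esub> = pres_rel X R `` {[]}"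
  by (simp add: presented_group_def)

lemma pres_rel_left_inverse:
  "w \<in> gwords X \<Longrightarrow> \<exists>v\<in>gwords X. (v @ w, []) \<in> pres_rel X R"
proof (induction w)
  case Nil
  have "([] @ [], []) \<in> pres_rel X R" by (simp add: pres_rel.refl)
  then show ?case by (meson gwords_Nil)
next
  case (Cons a w)
  obtain x b where a: "a = (x, b)" by (cases a)
  from Cons a obtain v where v: "v \<in> gwords X" "(v @ w, []) \<in> pres_rel X R" by auto
  have "((v @ [(x, \<not> b)]) @ (a # w), v @ w) \<in> pres_rel X R"
    using pres_rel.cancel[of v X w x "\<not> b" R] Cons a v by simp
  then have "((v @ [(x, \<not> b)]) @ (a # w), []) \<in> pres_rel X R"
    by (rule pres_rel.trans[OF _ v(2)])
  moreover have "v @ [(x, \<not> b)] \<in> gwords X" using v Cons a by simp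
  ultimately show ?case by blast
qed

lemma group_presented_group: "group (presented_group X R)"
proof (rule groupI)
  let ?G = "presented_group X R"
  fix A B assume "A \<in> carrier ?G" "B \<in> carrier ?G"
  then show "A \<otimes>\<^bsub>?G\<^esub> B \<in> carrier ?G"
    by (elim presented_carrierE) (simp add: presented_mult presented_carrierI)
next
  let ?G = "presented_group X R"
  show "\<one>\<^bsub>?G\<^esub> \<in> carrier ?G" by (simp add: presented_one presented_carrierI)
next
  let ?G = "presented_group X R"
  fix A B C assume "A \<in> carrier ?G" "B \<in> carrier ?G" "C \<in> carrier ?G"
  then show "A \<otimes>\<^bsub>?G\<^esub> B \<otimes>\<^bsub>?G\<^esub> C = A \<otimes>\<^bsub>?G\<^esub> (B \<otimes>\<^bsub>?G\<^esub> C)"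
    by (elim presented_carrierE) (simp add: presented_mult)
next
  let ?G = "presented_group X R"
  fix A assume "A \<in> carrier ?G"
  then show "\<one>\<^bsub>?G\<^esub> \<otimes>\<^bsub>?G\<^esub> A = A"
    by (elim presented_carrierE) (simp add: presented_one presented_mult)
next
  let ?G = "presented_group X R"
  fix A assume "A \<in> carrier ?G"
  then obtain w where w: "w \<in> gwords X" "A = pres_rel X R `` {w}"
    by (rule presented_carrierE)
  from pres_rel_left_inverse[OF w(1)] obtain v
    where v: "v \<in> gwords X" "(v @ w, []) \<in> pres_rel X R" by blast
  have "pres_rel X R `` {v} \<otimes>\<^bsub>?G\<^esub> A = \<one>\<^bsub>?G\<^esub>"
    using w v equiv_class_eq[OF equiv_pres_rel v(2)] by (simp add: presented_mult presented_one)
  with v show "\<exists>B\<in>carrier ?G. B \<otimes>\<^bsub>?G\<^esub> A = \<one>\<^bsub>?G\<^esub>"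
    using presented_carrierI by blast
qed

lemma group_racg: "group (racg V E)"
  by (simp add: racg_def group_presented_group)

lemma racg_gens_carrier: "racg_gens V E \<subseteq> carrier (racg V E)"
  by (auto simp: racg_gens_def racg_def pres_gen_def intro!: presented_carrierI)

lemma racg_gens_finite: "finite V \<Longrightarrow> finite (racg_gens V E)"
  by (simp add: racg_gens_def)

text \<open>The formal inverse of a generator represents the same group element as the generator.\<close>

lemma racg_inverse_letter:
  assumes "x \<in> V"
  shows "([(x, b)], [(x, True)]) \<in> pres_rel V (racg_relations V E)"
proof (cases b)
  case True
  with assms show ?thesis by (auto intro: pres_rel.refl)
next
  case False
  let ?R = "racg_relations V E"
  have "([(x, True), (x, True)], []) \<in> ?R"
    using assms unfolding racg_relations_def by blast
  then have "([(x, False), (x, True), (x, True)], [(x, False)]) \<in> pres_rel V ?R"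
    using pres_rel.rel[of "[(x, False)]" V "[]" "[(x, True), (x, True)]" "[]" ?R] assms by simp
  moreover have "([(x, False), (x, True), (x, True)], [(x, True)]) \<in> pres_rel V ?R"
    using pres_rel.cancel[of "[]" V "[(x, True)]" x False ?R] assms by simp
  ultimately have "([(x, False)], [(x, True)]) \<in> pres_rel V ?R"
    by (rule pres_rel.trans[OF pres_rel.sym])
  then show ?thesis using False by simp
qed

text \<open>The standard generating set generates the group as a monoid.\<close>

lemma racg_gens_generate:
  assumes "g \<in> carrier (racg V E)"
  shows "\<exists>w\<in>lists (racg_gens V E). word_value (racg V E) w = g"
proof -
  let ?R = "racg_relations V E"
  have "\<exists>ws\<in>lists (racg_gens V E). word_value (racg V E) ws = pres_rel V ?R `` {w}"
    if "w \<in> gwords V" for w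
    using that
  proof (induction w)
    case Nil
    have "word_value (racg V E) [] = pres_rel V ?R `` {[]}"
      by (simp add: word_value_def racg_def presented_one)
    then show ?case by blast
  next
    case (Cons a w)
    obtain x b where a: "a = (x, b)" by (cases a)
    with Cons have x: "x \<in> V" and w: "w \<in> gwords V" by auto
    from Cons.IH[OF w] obtain ws where ws: "ws \<in> lists (racg_gens V E)"
      "word_value (racg V E) ws = pres_rel V ?R `` {w}" by blast
    have gen: "pres_gen V ?R x = pres_rel V ?R `` {[a]}"
      using equiv_class_eq[OF equiv_pres_rel racg_inverse_letter[OF x, of b E]]
      by (simp add: pres_gen_def a)
    have "word_value (racg V E) (pres_gen V ?R x # ws) = pres_rel V ?R `` {a # w}"
      using ws x w presented_mult[of "[a]" V w ?R] a
      by (simp add: word_value_def gen racg_def)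
    moreover have "pres_gen V ?R x # ws \<in> lists (racg_gens V E)"
      using ws x by (auto simp: racg_gens_def)
    ultimately show ?case by blast
  qed
  with assms show ?thesis unfolding racg_def by (elim presented_carrierE) blast
qed

end

theory Submission
  imports Defs
begin

text \<open>A word is combinatorially reduced if no letter can be shuffled next to another copy
  of itself. In the dual geometric representation, the image of the all-one vector under a
  reduced word has its negative coordinates exactly at the letters which can be shuffled to
  the front (the left descents), so the descent set depends only on the group element; hence
  reduced words are geodesic. The left descent set of a word is a clique, and reading one
  more letter \<open>v\<close> replaces \<open>\<sigma>\<close> by \<open>{v} \<union> (\<sigma> \<inter> Lk(v))\<close>. Without \<open>4\<close>-cliques
  the number of ways to reach a descent set of given size depends only on \<open>|\<sigma>| \<le> 3\<close>
  and \<open>n, l, q\<close>, by inclusion and exclusion, which gives a linear system for three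
  generating functions.\<close>

section \<open>Reduced words\<close>

fun descents :: "'a set set \<Rightarrow> 'a list \<Rightarrow> 'a set" where
  "descents E [] = {}"
| "descents E (v # w) = insert v {u \<in> descents E w. {u, v} \<in> E}"

text \<open>Words grow at the front, by a letter outside the current descent set. Reduced words are
  thus the paths of an automaton whose states are the descent sets.\<close>

fun reduced :: "'a set set \<Rightarrow> 'a list \<Rightarrow> bool" where
  "reduced E [] \<longleftrightarrow> True"
| "reduced E (v # w) \<longleftrightarrow> v \<notin> descents E w \<and> reduced E w"

lemma simplicial_graph_edge:
  assumes "simplicial_graph V E" "{u, v} \<in> E"
  shows "u \<noteq> v" "u \<in> V" "v \<in> V"
  using assms by (auto simp: simplicial_graph_def)

lemma finite_descents: "finite (descents E w)"
  by (induction w) auto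

lemma descents_subset: "descents E w \<subseteq> set w"
  by (induction w) auto

text \<open>A new first letter keeps only those earlier descents that are adjacent to it, so
  pairwise adjacency survives each step of the recursion.\<close>

lemma descents_edge:
  "u \<in> descents E w \<Longrightarrow> v \<in> descents E w \<Longrightarrow> u \<noteq> v \<Longrightarrow> {u, v} \<in> E"
  by (induction w) (auto simp: insert_commute)

lemma clique_descents:
  assumes "w \<in> lists V"
  shows "clique V E (descents E w)"
proof -
  have "descents E w \<subseteq> V"
    using descents_subset[of E w] assms by auto
  then show ?thesis
    by (auto simp: clique_def intro: descents_edge)
qed

section \<open>The dual geometric representation\<close>

text \<open>The function \<open>f\<close> lists the values of a linear functional on the simple
  roots. The bilinear form is 0 on edges and -1 on non-adjacent pairs, so \<open>v\<close> sends the
  simple root of a non-neighbour \<open>u\<close> to itself plus twice the root of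
  \<open>v\<close>.\<close>

definition vertex_refl :: "'a set set \<Rightarrow> 'a \<Rightarrow> ('a \<Rightarrow> int) \<Rightarrow> 'a \<Rightarrow> int" where
  "vertex_refl E v f = (\<lambda>u. if u = v then - f v else if {u, v} \<in> E then f u else f u + 2 * f v)"

definition word_act :: "'a set set \<Rightarrow> 'a list \<Rightarrow> ('a \<Rightarrow> int) \<Rightarrow> 'a \<Rightarrow> int" where
  "word_act E w = foldr (vertex_refl E) w"

lemma word_act_append: "word_act E (u @ v) f = word_act E u (word_act E v f)"
  by (simp add: word_act_def)

lemma vertex_refl_involution: "vertex_refl E v (vertex_refl E v f) = f"
  by (auto simp: vertex_refl_def)

lemma vertex_refl_commute:
  assumes "{u, v} \<in> E"
  shows "vertex_refl E u (vertex_refl E v f) = vertex_refl E v (vertex_refl E u f)"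
  using assms by (auto simp: vertex_refl_def insert_commute)

lemma word_act_pres_rel:
  assumes "(u, w) \<in> pres_rel V (racg_relations V E)"
  shows "word_act E (map fst u) = word_act E (map fst w)"
  using assms
proof (induction rule: pres_rel.induct)
  case (cancel u v x b)
  then show ?case
    by (auto simp: word_act_append fun_eq_iff) (simp add: word_act_def vertex_refl_involution)
next
  case (rel u v r s)
  have "word_act E (map fst r) = word_act E (map fst s)"
    using rel(5) by (auto simp: racg_relations_def word_act_def comp_def
        vertex_refl_involution intro!: ext fun_cong[OF vertex_refl_commute])
  then show ?case by (intro ext) (simp add: word_act_append)
qed auto

text \<open>The strict inequality for pairs is what makes the induction work: it forces a
  negative coordinate to become positive when a non-adjacent reflection is applied.\<close>

lemma word_act_reduced:
  assumes "reduced E w"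
  shows "(\<forall>u. u \<in> descents E w \<longrightarrow> word_act E w (\<lambda>_. 1) u < 0) \<and>
    (\<forall>u. u \<notin> descents E w \<longrightarrow> word_act E w (\<lambda>_. 1) u > 0) \<and>
    (\<forall>u v. u \<in> descents E w \<longrightarrow> v \<notin> descents E w \<longrightarrow> {u, v} \<notin> E \<longrightarrow>
        word_act E w (\<lambda>_. 1) u + word_act E w (\<lambda>_. 1) v > 0)"
  using assms
proof (induction w)
  case Nil
  then show ?case by (simp add: word_act_def)
next
  case (Cons x w)
  define f where "f = word_act E w (\<lambda>_. 1)"
  define D where "D = descents E w"
  have x: "x \<notin> D" using Cons.prems by (simp add: D_def)
  have neg: "\<And>u. u \<in> D \<Longrightarrow> f u < 0" and pos: "\<And>u. u \<notin> D \<Longrightarrow> f u > 0"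
    and sum: "\<And>u v. u \<in> D \<Longrightarrow> v \<notin> D \<Longrightarrow> {u, v} \<notin> E \<Longrightarrow> f u + f v > 0"
    using Cons by (auto simp: D_def f_def)
  have D: "\<And>u v. u \<in> D \<Longrightarrow> v \<in> D \<Longrightarrow> u \<noteq> v \<Longrightarrow> {u, v} \<in> E"
    unfolding D_def by (rule descents_edge)
  have act: "word_act E (x # w) (\<lambda>_. 1) = vertex_refl E x f"
    by (simp add: word_act_def f_def)
  have desc: "descents E (x # w) = insert x {u \<in> D. {u, x} \<in> E}"
    by (simp add: D_def)
  have fx: "f x > 0" using x pos by simp
  \<comment> \<open>If \<open>u\<close> is in \<open>D\<close>, this is the pair inequality for
    \<open>u\<close> and \<open>x\<close>; otherwise both terms are positive.\<close>
  have far: "f u + f x > 0" if "{u, x} \<notin> E" for u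
    using sum[of u x] pos[of u] that x fx by (cases "u \<in> D") auto
  have 1: "vertex_refl E x f u < 0" if "u \<in> insert x {u \<in> D. {u, x} \<in> E}" for u
    using that neg fx by (auto simp: vertex_refl_def)
  \<comment> \<open>A coordinate not adjacent to \<open>x\<close> becomes
    \<open>(f u + f x) + f x\<close>, positive by \<open>far\<close>; an adjacent one is unchanged
    and lies outside \<open>D\<close>.\<close>
  have 2: "vertex_refl E x f u > 0" if "u \<notin> insert x {u \<in> D. {u, x} \<in> E}" for u
    using that far[of u] fx pos[of u] by (auto simp: vertex_refl_def)
  \<comment> \<open>For \<open>u = x\<close> the sum is \<open>- f x + (f v + 2 * f x)\<close>.
    Otherwise \<open>u\<close> is adjacent to \<open>x\<close> and keeps its value, \<open>v\<close>
    cannot lie in the clique \<open>D\<close>, and its value does not decrease.\<close>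
  have 3: "vertex_refl E x f u + vertex_refl E x f v > 0"
    if u: "u \<in> insert x {u \<in> D. {u, x} \<in> E}" and v: "v \<notin> insert x {u \<in> D. {u, x} \<in> E}"
      and uv: "{u, v} \<notin> E" for u v
  proof (cases "u = x")
    case True
    then show ?thesis
      using far[of v] v uv by (auto simp: vertex_refl_def insert_commute)
  next
    case False
    then have uD: "u \<in> D" "{u, x} \<in> E" using u by auto
    have "v \<notin> D" using D[of u v] uD uv v by auto
    then have "f u + f v > 0" using sum[of u v] uD uv by auto
    then show ?thesis
      using False uD v fx by (auto simp: vertex_refl_def)
  qed
  from 1 2 3 show ?case unfolding act desc by blast
qed

text \<open>The right-hand side depends only on the operator \<open>word_act E w\<close>, hence only
  on the group element.\<close>

lemma descents_eq_negative:
  assumes "reduced E w"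
  shows "descents E w = {u. word_act E w (\<lambda>_. 1) u < 0}"
  using word_act_reduced[OF assms] by (force simp: not_less[symmetric])

section \<open>Geodesics are reduced words\<close>

text \<open>Words over \<open>V\<close> are compared through their all-positive signed words, so
  that the combinatorics can be done without formal inverses.\<close>

definition racg_eq :: "'a set \<Rightarrow> 'a set set \<Rightarrow> 'a list \<Rightarrow> 'a list \<Rightarrow> bool" where
  "racg_eq V E u w \<longleftrightarrow>
     (map (\<lambda>v. (v, True)) u, map (\<lambda>v. (v, True)) w) \<in> pres_rel V (racg_relations V E)"

lemma positive_gwords: "map (\<lambda>v. (v, True)) w \<in> gwords V \<longleftrightarrow> w \<in> lists V"
  by (auto simp: gwords_def)

lemma racg_eq_lists: "racg_eq V E u w \<Longrightarrow> u \<in> lists V \<and> w \<in> lists V"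
  unfolding racg_eq_def using pres_rel_gwords positive_gwords by metis

lemma racg_eq_refl: "w \<in> lists V \<Longrightarrow> racg_eq V E w w"
  unfolding racg_eq_def by (rule pres_rel.refl) (simp add: positive_gwords)

lemma racg_eq_sym: "racg_eq V E u w \<Longrightarrow> racg_eq V E w u"
  unfolding racg_eq_def by (rule pres_rel.sym)

lemma racg_eq_trans: "racg_eq V E u v \<Longrightarrow> racg_eq V E v w \<Longrightarrow> racg_eq V E u w"
  unfolding racg_eq_def by (rule pres_rel.trans)

lemma racg_eq_append:
  "racg_eq V E u u' \<Longrightarrow> racg_eq V E w w' \<Longrightarrow> racg_eq V E (u @ w) (u' @ w')"
  unfolding racg_eq_def by (simp add: pres_rel_append)

lemma racg_eq_Cons:
  assumes "racg_eq V E u w" "v \<in> V"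
  shows "racg_eq V E (v # u) (v # w)"
  using racg_eq_append[OF racg_eq_refl[of "[v]"] assms(1)] assms(2) by simp

lemma racg_eq_square:
  assumes "v \<in> V" "w \<in> lists V"
  shows "racg_eq V E (v # v # w) w"
proof -
  have "([(v, True), (v, True)], []) \<in> racg_relations V E"
    using assms by (auto simp: racg_relations_def)
  then have "([] @ [(v, True), (v, True)] @ map (\<lambda>v. (v, True)) w,
      [] @ [] @ map (\<lambda>v. (v, True)) w) \<in> pres_rel V (racg_relations V E)"
    using assms by (intro pres_rel.rel) (auto simp: positive_gwords)
  then show ?thesis by (simp add: racg_eq_def)
qed

lemma racg_eq_swap:
  assumes "{u, v} \<in> E" "u \<in> V" "v \<in> V" "w \<in> lists V"
  shows "racg_eq V E (u # v # w) (v # u # w)"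
proof -
  have "([(u, True), (v, True)], [(v, True), (u, True)]) \<in> racg_relations V E"
    using assms by (auto simp: racg_relations_def)
  then have "([] @ [(u, True), (v, True)] @ map (\<lambda>v. (v, True)) w,
      [] @ [(v, True), (u, True)] @ map (\<lambda>v. (v, True)) w) \<in> pres_rel V (racg_relations V E)"
    using assms by (intro pres_rel.rel) (auto simp: positive_gwords)
  then show ?thesis by (simp add: racg_eq_def)
qed

text \<open>Each generator is its own inverse: prepend another \<open>v\<close> on both sides and
  remove the squares.\<close>

lemma racg_eq_Cons_cancel:
  assumes "racg_eq V E (v # u) (v # w)"
  shows "racg_eq V E u w"
proof -
  have v: "v \<in> V" "u \<in> lists V" "w \<in> lists V"
    using racg_eq_lists[OF assms] by auto
  have "racg_eq V E u (v # v # u)" "racg_eq V E (v # v # w) w"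
    using racg_eq_sym racg_eq_square v by metis+
  moreover have "racg_eq V E (v # v # u) (v # v # w)"
    using racg_eq_Cons[OF assms] v by simp
  ultimately show ?thesis
    using racg_eq_trans by metis
qed

lemma racg_eq_word_act:
  assumes "racg_eq V E u w"
  shows "word_act E u = word_act E w"
  using word_act_pres_rel[OF assms[unfolded racg_eq_def]] by (simp add: comp_def)

lemma racg_eq_descents:
  assumes "racg_eq V E u w" "reduced E u" "reduced E w"
  shows "descents E u = descents E w"
  using assms descents_eq_negative racg_eq_word_act by metis

text \<open>A descent other than the first letter \<open>v\<close> is a descent of the tail adjacent
  to \<open>v\<close>: move it to the front of the tail, then swap it with \<open>v\<close>.
  Equality of the descent sets is carried along because the induction needs that \<open>v\<close> is
  still no descent of the rearranged tail.\<close>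

lemma descent_to_front:
  assumes "w \<in> lists V" "reduced E w" "x \<in> descents E w"
  shows "\<exists>w'. racg_eq V E w (x # w') \<and> reduced E (x # w') \<and> Suc (length w') = length w \<and>
    descents E (x # w') = descents E w"
  using assms
proof (induction w)
  case (Cons v t)
  show ?case
  proof (cases "x = v")
    case True
    then show ?thesis using Cons racg_eq_refl[of "v # t" V E]
      by (intro exI[of _ t]) simp
  next
    case False
    then have x: "x \<in> descents E t" "{x, v} \<in> E" using Cons.prems by auto
    then obtain s where s: "racg_eq V E t (x # s)" "reduced E (x # s)"
      "Suc (length s) = length t" "descents E (x # s) = descents E t"
      using Cons by auto
    have V: "v \<in> V" "x \<in> V" "s \<in> lists V"
      using Cons racg_eq_lists[OF s(1)] by auto
    have "racg_eq V E (v # t) (x # v # s)"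
      using racg_eq_trans[OF racg_eq_Cons[OF s(1) V(1)] racg_eq_swap[of v x E V s]] V x
      by (simp add: insert_commute)
    moreover have "v \<notin> descents E (x # s)" using Cons.prems s by simp
    \<comment> \<open>If \<open>v\<close> were a descent of \<open>s\<close>, it could be moved past
      its neighbour \<open>x\<close> and would be a descent of \<open>x # s\<close>.\<close>
    then have "reduced E (x # v # s)"
      using s(2) x False by (auto simp: insert_commute)
    moreover have "descents E (x # v # s) = descents E (v # t)"
      using x False s(4)[symmetric] by (auto simp: insert_commute)
    ultimately show ?thesis using s(3) by (intro exI[of _ "v # s"]) auto
  qed
qed simp

text \<open>At the rightmost failure the tail is reduced and has the preceding letter as a descent;
  moving this descent to the front of the tail creates a square, which is removed.\<close>

lemma not_reduced_shorten:
  assumes "w \<in> lists V" "\<not> reduced E w"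
  shows "\<exists>w'. racg_eq V E w w' \<and> length w' < length w"
  using assms
proof (induction w)
  case (Cons v t)
  then have V: "v \<in> V" "t \<in> lists V" by auto
  show ?case
  proof (cases "reduced E t")
    case True
    then have "v \<in> descents E t" using Cons.prems by simp
    with True V obtain s where s: "racg_eq V E t (v # s)" "Suc (length s) = length t"
      using descent_to_front[where V = V and E = E] by blast
    have "racg_eq V E (v # t) (v # v # s)" using s V by (intro racg_eq_Cons)
    moreover have "racg_eq V E (v # v # s) s"
      using racg_eq_lists[OF s(1)] by (intro racg_eq_square) auto
    ultimately have "racg_eq V E (v # t) s" by (rule racg_eq_trans)
    then show ?thesis using s by (intro exI[of _ s]) auto
  next
    case False
    then obtain s where "racg_eq V E t s" "length s < length t" using Cons V by auto
    then show ?thesis using racg_eq_Cons V by (intro exI[of _ "v # s"]) auto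
  qed
qed simp

text \<open>Induction on the length of \<open>u\<close>. A non-reduced \<open>u\<close> is replaced
  by a shorter equal word. A reduced \<open>u\<close> has the same descents as \<open>w\<close>, so
  its first letter can be moved to the front of \<open>w\<close> and cancelled from both.\<close>

lemma reduced_length_le:
  assumes "reduced E w" "racg_eq V E u w"
  shows "length w \<le> length u"
  using assms
proof (induction "length u" arbitrary: u w rule: less_induct)
  case less
  show ?case
  proof (cases "reduced E u")
    case False
    then obtain u' where u': "racg_eq V E u u'" "length u' < length u"
      using not_reduced_shorten[where V = V and E = E] racg_eq_lists less.prems by metis
    then have "length w \<le> length u'"
      using less.hyps[OF u'(2)] less.prems racg_eq_sym racg_eq_trans by metis
    then show ?thesis using u' by simp
  next
    case True
    then have desc: "descents E u = descents E w"
      using racg_eq_descents[where V = V and E = E] less.prems by metis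
    show ?thesis
    proof (cases u)
      case Nil
      then have "descents E w = {}" using desc by simp
      then show ?thesis by (cases w) auto
    next
      case (Cons x u')
      then have x: "x \<in> descents E w" using desc by auto
      have "w \<in> lists V" using racg_eq_lists[OF less.prems(2)] by simp
      from descent_to_front[OF this less.prems(1) x] obtain w' where
        w': "racg_eq V E w (x # w')" "reduced E (x # w')" "Suc (length w') = length w"
        by blast
      have "racg_eq V E u' w'"
        using racg_eq_trans[OF less.prems(2) w'(1)] Cons by (auto intro: racg_eq_Cons_cancel)
      then have "length w' \<le> length u'"
        using less.hyps[of u' w'] Cons w'(2) by auto
      then show ?thesis using w'(3) Cons by simp
    qed
  qed
qed

section \<open>Evaluation in the presented group and geodesics\<close>

lemma word_value_pres_gen:
  assumes "w \<in> lists V"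
  shows "word_value (racg V E) (map (pres_gen V (racg_relations V E)) w) =
    pres_rel V (racg_relations V E) `` {map (\<lambda>v. (v, True)) w}"
  using assms
proof (induction w)
  case Nil
  then show ?case by (simp add: word_value_def racg_def presented_one)
next
  case (Cons v w)
  then show ?case
    using presented_mult[of "[(v, True)]" V "map (\<lambda>v. (v, True)) w" "racg_relations V E"]
    by (simp add: word_value_def racg_def pres_gen_def positive_gwords)
qed

lemma word_value_eq_iff:
  assumes "u \<in> lists V" "w \<in> lists V"
  shows "word_value (racg V E) (map (pres_gen V (racg_relations V E)) u) =
    word_value (racg V E) (map (pres_gen V (racg_relations V E)) w) \<longleftrightarrow> racg_eq V E u w"
  using assms
  by (simp add: word_value_pres_gen racg_eq_def eq_equiv_class_iff[OF equiv_pres_rel]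
      positive_gwords del: in_lists_conv_set)

text \<open>One-letter words are reduced, and the descent set of \<open>[u]\<close> is
  \<open>{u}\<close>. Injectivity lets words in the group generators be counted as words over
  \<open>V\<close>.\<close>

lemma inj_on_pres_gen:
  shows "inj_on (pres_gen V (racg_relations V E)) V"
proof (rule inj_onI)
  fix u v assume V: "u \<in> V" "v \<in> V"
    and eq: "pres_gen V (racg_relations V E) u = pres_gen V (racg_relations V E) v"
  have "racg_eq V E [u] [v]"
    using word_value_eq_iff[of "[u]" V "[v]" E] V eq by simp
  then have "descents E [u] = descents E [v]"
    by (rule racg_eq_descents) auto
  then show "u = v" by simp
qed

lemma geodesic_iff_reduced:
  assumes "w \<in> lists V"
  shows "geodesic (racg V E) (racg_gens V E) (map (pres_gen V (racg_relations V E)) w) \<longleftrightarrow>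
    reduced E w"
proof -
  let ?g = "pres_gen V (racg_relations V E)"
  let ?P = "\<lambda>k. \<exists>u\<in>lists (racg_gens V E).
    word_value (racg V E) u = word_value (racg V E) (map ?g w) \<and> length u = k"
  \<comment> \<open>The minimum over words in the group generators is a minimum over words over
    \<open>V\<close>, since every such word lifts along \<open>?g\<close>.\<close>
  have P: "?P k \<longleftrightarrow> (\<exists>u. racg_eq V E u w \<and> length u = k)" for k
  proof -
    have "?P k \<longleftrightarrow> (\<exists>u\<in>lists V.
      word_value (racg V E) (map ?g u) = word_value (racg V E) (map ?g w) \<and> length u = k)"
      by (simp add: racg_gens_def lists_image del: in_lists_conv_set)
    also have "\<dots> \<longleftrightarrow> (\<exists>u. racg_eq V E u w \<and> length u = k)"
      using word_value_eq_iff[OF _ assms] racg_eq_lists by blast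
    finally show ?thesis .
  qed
  have "map ?g w \<in> lists (racg_gens V E)"
    using assms by (auto simp: racg_gens_def)
  then have geo: "geodesic (racg V E) (racg_gens V E) (map ?g w) \<longleftrightarrow>
    length w = (LEAST k. \<exists>u. racg_eq V E u w \<and> length u = k)"
    unfolding geodesic_def P by simp
  show ?thesis
  proof
    assume "geodesic (racg V E) (racg_gens V E) (map ?g w)"
    then have len: "length w = (LEAST k. \<exists>u. racg_eq V E u w \<and> length u = k)"
      using geo by simp
    show "reduced E w"
    proof (rule ccontr)
      assume "\<not> reduced E w"
      then obtain w' where w': "racg_eq V E w w'" "length w' < length w"
        using not_reduced_shorten[OF assms] by blast
      then have "\<exists>u. racg_eq V E u w \<and> length u = length w'"
        using racg_eq_sym by blast
      then have "length w \<le> length w'"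
        unfolding len by (rule Least_le)
      then show False using w' by simp
    qed
  next
    assume "reduced E w"
    then have "(LEAST k. \<exists>u. racg_eq V E u w \<and> length u = k) = length w"
      using reduced_length_le[where V = V and E = E] racg_eq_refl[OF assms]
      by (intro Least_equality) blast+
    then show "geodesic (racg V E) (racg_gens V E) (map ?g w)"
      using geo by simp
  qed
qed

definition reduced_words :: "'a set \<Rightarrow> 'a set set \<Rightarrow> nat \<Rightarrow> 'a list set" where
  "reduced_words V E i = {w \<in> lists V. reduced E w \<and> length w = i}"

lemma card_geodesics:
  shows "card {w. geodesic (racg V E) (racg_gens V E) w \<and> length w = i} =
    card (reduced_words V E i)"
proof -
  let ?g = "pres_gen V (racg_relations V E)"
  have "{w. geodesic (racg V E) (racg_gens V E) w \<and> length w = i} =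
    map ?g ` reduced_words V E i"
  proof (intro equalityI subsetI)
    fix w assume w: "w \<in> {w. geodesic (racg V E) (racg_gens V E) w \<and> length w = i}"
    then have "w \<in> map ?g ` lists V"
      by (simp add: geodesic_def racg_gens_def lists_image del: in_lists_conv_set)
    then obtain u where "u \<in> lists V" "w = map ?g u" by blast
    then show "w \<in> map ?g ` reduced_words V E i"
      using w geodesic_iff_reduced[where V = V and E = E] by (auto simp: reduced_words_def)
  qed (use geodesic_iff_reduced[where V = V and E = E] in \<open>auto simp: reduced_words_def\<close>)
  moreover have "inj_on (map ?g) (reduced_words V E i)"
    by (rule inj_on_subset[OF inj_on_map_lists[OF inj_on_pres_gen]])
      (auto simp: reduced_words_def)
  ultimately show ?thesis by (simp add: card_image)
qed

section \<open>Counting reduced words by the size of the descent set\<close>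

text \<open>Counts the letters that can be put before a word with descent set \<sigma> so that
  exactly \<open>k\<close> old descents survive. Indicator sums are used here and in
  \<open>descent_count\<close> to make inclusion-exclusion and summation over words linear.\<close>

definition extensions :: "'a set \<Rightarrow> 'a set set \<Rightarrow> 'a set \<Rightarrow> nat \<Rightarrow> int" where
  "extensions V E \<sigma> k = (\<Sum>v\<in>V - \<sigma>. of_bool (card {u \<in> \<sigma>. {u, v} \<in> E} = k))"

definition descent_count :: "'a set \<Rightarrow> 'a set set \<Rightarrow> nat \<Rightarrow> nat \<Rightarrow> int" where
  "descent_count V E k i = (\<Sum>w\<in>reduced_words V E i. of_bool (card (descents E w) = k))"

lemma finite_reduced_words:
  assumes "finite V"
  shows "finite (reduced_words V E i)"
  by (rule finite_subset[OF _ finite_lists_length_eq[OF assms, of i]])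
    (auto simp: reduced_words_def)

text \<open>A nonempty reduced word splits uniquely into a reduced tail and a first letter outside
  the descents of the tail.\<close>

lemma sum_reduced_words_Suc:
  fixes f :: "'a list \<Rightarrow> int"
  assumes "finite V"
  shows "(\<Sum>w\<in>reduced_words V E (Suc i). f w) =
    (\<Sum>w\<in>reduced_words V E i. \<Sum>v\<in>V - descents E w. f (v # w))"
proof -
  have "reduced_words V E (Suc i) =
    (\<lambda>(w, v). v # w) ` (SIGMA w:reduced_words V E i. V - descents E w)"
  proof (intro equalityI subsetI)
    fix w assume "w \<in> reduced_words V E (Suc i)"
    then show "w \<in> (\<lambda>(w, v). v # w) ` (SIGMA w:reduced_words V E i. V - descents E w)"
      by (cases w) (force simp: reduced_words_def)+
  qed (auto simp: reduced_words_def)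
  moreover have "inj_on (\<lambda>(w, v). v # w) (SIGMA w:reduced_words V E i. V - descents E w)"
    by (auto intro: inj_onI)
  ultimately show ?thesis
    by (simp add: sum.reindex sum.Sigma finite_reduced_words assms case_prod_unfold)
qed

text \<open>The index shifts from \<open>k\<close> to \<open>Suc k\<close> because the new letter is
  itself a descent besides the \<open>k\<close> surviving ones.\<close>

lemma descent_count_Suc:
  assumes "finite V"
  shows "descent_count V E (Suc k) (Suc i) =
    (\<Sum>w\<in>reduced_words V E i. extensions V E (descents E w) k)"
proof -
  have "card (descents E (v # w)) = Suc (card {u \<in> descents E w. {u, v} \<in> E})"
    if "v \<in> V - descents E w" for v w
    using that finite_descents[of E w] by simp
  then show ?thesis
    unfolding descent_count_def sum_reduced_words_Suc[OF assms] extensions_def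
    by (intro sum.cong[OF HOL.refl]) simp
qed

section \<open>Neighbour counts in the graph\<close>

lemma card_neighbours:
  assumes "simplicial_graph V E" "regular_graph V E l" "a \<in> V"
  shows "card {v. {a, v} \<in> E} = l"
proof -
  have "\<exists>v. e = {a, v}" if "e \<in> E" "a \<in> e" for e
  proof -
    have "card e = 2" using assms(1) that by (simp add: simplicial_graph_def)
    then obtain x y where "e = {x, y}" by (metis card_2_iff)
    then show ?thesis using that(2) by blast
  qed
  then have "bij_betw (\<lambda>v. {a, v}) {v. {a, v} \<in> E} {e \<in> E. a \<in> e}"
    by (intro bij_betw_imageI inj_onI equalityI subsetI) (fastforce simp: doubleton_eq_iff)+
  then have "card {v. {a, v} \<in> E} = card {e \<in> E. a \<in> e}"
    by (rule bij_betw_same_card)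
  also have "\<dots> = l"
    using assms(2,3) by (simp add: regular_graph_def)
  finally show ?thesis .
qed

text \<open>Turns the link number \<open>q\<close> into a number of common neighbours, the form
  needed for inclusion-exclusion.\<close>

lemma link_edge:
  assumes "simplicial_graph V E" "{a, b} \<in> E"
  shows "link V E {a, b} = {v. {a, v} \<in> E \<and> {b, v} \<in> E}"
proof (intro equalityI subsetI)
  fix v assume "v \<in> link V E {a, b}"
  then have "v \<noteq> a" "v \<noteq> b" "clique V E {v, a, b}" by (auto simp: link_def)
  then have "{a, v} \<in> E" "{b, v} \<in> E" by (simp_all add: clique_def)
  then show "v \<in> {v. {a, v} \<in> E \<and> {b, v} \<in> E}" by simp
next
  fix v assume "v \<in> {v. {a, v} \<in> E \<and> {b, v} \<in> E}"
  then have v: "{a, v} \<in> E" "{b, v} \<in> E" by auto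
  then have "{v, a} \<in> E" "{v, b} \<in> E" "{b, a} \<in> E"
    using assms(2) by (simp_all add: insert_commute)
  then have "clique V E {v, a, b}"
    using v assms(2) simplicial_graph_edge(2,3)[OF assms(1,2)]
      simplicial_graph_edge(3)[OF assms(1) v(1)] by (simp add: clique_def)
  then show "v \<in> link V E {a, b}"
    using simplicial_graph_edge[OF assms(1) v(1)] simplicial_graph_edge[OF assms(1) v(2)]
    by (simp add: link_def)
qed

text \<open>Such a vertex would complete the triangle to a 4-clique. This removes the triple term
  from inclusion-exclusion.\<close>

lemma no_common_neighbour_of_triangle:
  assumes "simplicial_graph V E" "\<nexists>\<sigma>. clique V E \<sigma> \<and> card \<sigma> = 4"
    and "{a, b} \<in> E" "{a, c} \<in> E" "{b, c} \<in> E"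
  shows "\<not> ({a, v} \<in> E \<and> {b, v} \<in> E \<and> {c, v} \<in> E)"
proof
  assume "{a, v} \<in> E \<and> {b, v} \<in> E \<and> {c, v} \<in> E"
  with assms(3-) have edges: "{a, b} \<in> E" "{a, c} \<in> E" "{b, c} \<in> E"
    "{a, v} \<in> E" "{b, v} \<in> E" "{c, v} \<in> E" by auto
  then have "{b, a} \<in> E" "{c, a} \<in> E" "{c, b} \<in> E" "{v, a} \<in> E" "{v, b} \<in> E" "{v, c} \<in> E"
    by (simp_all add: insert_commute)
  moreover note edge = simplicial_graph_edge[OF assms(1)]
  have "{a, b, c, v} \<subseteq> V"
    using edge(2)[OF edges(1)] edge(3)[OF edges(1)] edge(3)[OF edges(2)] edge(3)[OF edges(4)]
    by simp
  ultimately have "clique V E {a, b, c, v}"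
    using edges by (simp add: clique_def)
  moreover have "card {a, b, c, v} = 4"
    using edges[THEN edge(1)] by simp
  ultimately show False using assms(2) by blast
qed

lemma sum_neighbours:
  assumes "finite V" "simplicial_graph V E" "\<And>v. P v \<Longrightarrow> {a, v} \<in> E"
  shows "(\<Sum>v\<in>V - \<sigma>. of_bool (P v) :: int) = int (card ({v. P v} - \<sigma>))"
proof -
  have "{v. P v} - \<sigma> = {v \<in> V - \<sigma>. P v}"
    using assms(3) simplicial_graph_edge[OF assms(2)] by blast
  then show ?thesis using assms(1) by (simp add: sum_of_bool_eq Int_def)
qed

text \<open>Inclusion-exclusion over the neighbours of \<sigma> outside \<sigma>. The indicators
  \<delta> merge the four possible sizes into formulas that are linear in them, ready to be summed
  over words.\<close>

lemma extensions_descents: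
  assumes "finite V" and graph: "simplicial_graph V E" and "card V = n"
    and no4: "\<nexists>\<sigma>. clique V E \<sigma> \<and> card \<sigma> = 4"
    and regular: "regular_graph V E l"
    and q: "\<forall>u v. {u, v} \<in> E \<longrightarrow> card (link V E {u, v}) = q"
    and \<sigma>: "clique V E \<sigma>"
  defines "\<delta> \<equiv> \<lambda>k. of_bool (card \<sigma> = k) :: int"
  shows "extensions V E \<sigma> 0 = int n * \<delta> 0 + (int n - 1 - int l) * \<delta> 1
      + (int n - 2 * int l + int q) * \<delta> 2 + (int n - 3 * int l + 3 * int q) * \<delta> 3"
    and "extensions V E \<sigma> 1 = int l * \<delta> 1 + 2 * (int l - 1 - int q) * \<delta> 2 + 3 * (int l - 2 * int q) * \<delta> 3"
    and "extensions V E \<sigma> 2 = int q * \<delta> 2 + 3 * (int q - 1) * \<delta> 3"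
    and "card \<sigma> \<in> {0, 1, 2, 3}"
proof -
  have V: "\<sigma> \<subseteq> V" and adj: "\<And>u v. u \<in> \<sigma> \<Longrightarrow> v \<in> \<sigma> \<Longrightarrow> u \<noteq> v \<Longrightarrow> {u, v} \<in> E"
    using \<sigma> by (auto simp: clique_def)
  have fin: "finite \<sigma>" using V assms(1) finite_subset by blast
  show card: "card \<sigma> \<in> {0, 1, 2, 3}"
  proof (rule ccontr)
    assume "card \<sigma> \<notin> {0, 1, 2, 3}"
    then have "4 \<le> card \<sigma>" by auto
    then obtain \<tau> where "\<tau> \<subseteq> \<sigma>" "card \<tau> = 4"
      by (metis obtain_subset_with_card_n)
    then have "clique V E \<tau> \<and> card \<tau> = 4" using \<sigma> by (auto simp: clique_def)
    then show False using no4 by blast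
  qed
  have irrefl: "{v, v} \<notin> E" for v using simplicial_graph_edge(1)[OF graph] by blast
  have nbr_finite: "finite {v. {a, v} \<in> E}" for a
    by (rule finite_subset[OF _ assms(1)]) (use simplicial_graph_edge(3)[OF graph] in blast)
  have size: "(\<Sum>v\<in>V - \<sigma>. 1 :: int) = int n - card \<sigma>"
    using V fin assms(1,3) card_mono[OF assms(1) V] by (simp add: card_Diff_subset of_nat_diff)
  \<comment> \<open>Of the \<open>l\<close> neighbours of \<open>a\<close>, the other elements of
    the clique \<sigma> are excluded.\<close>
  have one: "(\<Sum>v\<in>V - \<sigma>. of_bool ({a, v} \<in> E) :: int) = int l + 1 - card \<sigma>" if "a \<in> \<sigma>" for a
  proof -
    have "\<sigma> - {a} \<subseteq> {v. {a, v} \<in> E}" using adj that by auto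
    moreover have "{v. {a, v} \<in> E} - \<sigma> = {v. {a, v} \<in> E} - (\<sigma> - {a})"
      using irrefl by auto
    moreover have "card {v. {a, v} \<in> E} = l"
      using card_neighbours[OF graph regular, of a] that V by blast
    ultimately have "int (card ({v. {a, v} \<in> E} - \<sigma>)) = int l - int (card (\<sigma> - {a}))"
      using card_mono[OF nbr_finite[of a], of "\<sigma> - {a}"]
      by (simp add: card_Diff_subset[of "\<sigma> - {a}"] fin of_nat_diff
          del: card_Diff_insert card_Diff_singleton)
    moreover have "int (card (\<sigma> - {a})) = int (card \<sigma>) - 1"
      using card_Suc_Diff1[OF fin that] by linarith
    ultimately show ?thesis
      using sum_neighbours[OF assms(1) graph, of "\<lambda>v. {a, v} \<in> E" a \<sigma>] by simp
  qed
  \<comment> \<open>Of the \<open>q\<close> common neighbours of \<open>a\<close> and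
    \<open>b\<close>, the remaining elements of \<sigma> are excluded.\<close>
  have two: "(\<Sum>v\<in>V - \<sigma>. of_bool ({a, v} \<in> E) * of_bool ({b, v} \<in> E) :: int) = int q + 2 - card \<sigma>"
    if ab: "a \<in> \<sigma>" "b \<in> \<sigma>" "a \<noteq> b" for a b
  proof -
    let ?N = "{v. {a, v} \<in> E \<and> {b, v} \<in> E}"
    have "finite ?N" using finite_subset[OF _ nbr_finite[of a], of ?N] by auto
    moreover have "\<sigma> - {a, b} \<subseteq> ?N" using adj ab by auto
    moreover have "?N - \<sigma> = ?N - (\<sigma> - {a, b})"
      using irrefl by auto
    moreover have "card ?N = q" using q link_edge[OF graph] adj ab by simp
    ultimately have "int (card (?N - \<sigma>)) = int q - int (card (\<sigma> - {a, b}))"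
      using card_mono[of ?N "\<sigma> - {a, b}"]
      by (simp add: card_Diff_subset[of "\<sigma> - {a, b}"] fin of_nat_diff del: card_Diff_insert)
    moreover have "int (card (\<sigma> - {a, b})) = int (card \<sigma>) - 2"
      using ab fin card_mono[OF fin, of "{a, b}"] by (simp add: card_Diff_subset of_nat_diff)
    ultimately show ?thesis
      using sum_neighbours[OF assms(1) graph, of "\<lambda>v. {a, v} \<in> E \<and> {b, v} \<in> E" a \<sigma>]
      by (simp add: of_bool_conj)
  qed
  consider "card \<sigma> = 0" | "card \<sigma> = 1" | "card \<sigma> = 2" | "card \<sigma> = 3"
    using card by auto
  then have "extensions V E \<sigma> 0 = int n * \<delta> 0 + (int n - 1 - int l) * \<delta> 1
        + (int n - 2 * int l + int q) * \<delta> 2 + (int n - 3 * int l + 3 * int q) * \<delta> 3 \<and>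
    extensions V E \<sigma> 1 = int l * \<delta> 1 + 2 * (int l - 1 - int q) * \<delta> 2 + 3 * (int l - 2 * int q) * \<delta> 3 \<and>
    extensions V E \<sigma> 2 = int q * \<delta> 2 + 3 * (int q - 1) * \<delta> 3"
  proof cases
    case 1
    then have "\<sigma> = {}" using fin by simp
    then show ?thesis using size by (simp add: extensions_def \<delta>_def)
  next
    case card: 2
    then obtain a where 2: "\<sigma> = {a}" by (rule card_1_singletonE)
    let ?A = "\<lambda>v. of_bool ({a, v} \<in> E) :: int"
    have eq: "{u \<in> \<sigma>. {u, v} \<in> E} = (if {a, v} \<in> E then {a} else {})" for v
      using 2 by auto
    have "extensions V E \<sigma> 0 = (\<Sum>v\<in>V - \<sigma>. 1 - ?A v)"
      "extensions V E \<sigma> 1 = (\<Sum>v\<in>V - \<sigma>. ?A v)"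
      "extensions V E \<sigma> 2 = (\<Sum>v\<in>V - \<sigma>. 0)"
      unfolding extensions_def eq by (intro sum.cong HOL.refl; simp)+
    note counts = this
    have in_\<sigma>: "a \<in> \<sigma>" using 2 by auto
    show ?thesis
      unfolding counts sum_subtractf size one[OF in_\<sigma>] card \<delta>_def by simp
  next
    case card: 3
    then obtain a b where 3: "\<sigma> = {a, b}" "a \<noteq> b" by (metis card_2_iff)
    let ?A = "\<lambda>v. of_bool ({a, v} \<in> E) :: int"
    let ?B = "\<lambda>v. of_bool ({b, v} \<in> E) :: int"
    have eq: "{u \<in> \<sigma>. {u, v} \<in> E} =
        (if {a, v} \<in> E then {a} else {}) \<union> (if {b, v} \<in> E then {b} else {})" for v
      using 3 by auto
    have "extensions V E \<sigma> 0 = (\<Sum>v\<in>V - \<sigma>. 1 - (?A v + ?B v) + ?A v * ?B v)"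
      "extensions V E \<sigma> 1 = (\<Sum>v\<in>V - \<sigma>. ?A v + ?B v - 2 * (?A v * ?B v))"
      "extensions V E \<sigma> 2 = (\<Sum>v\<in>V - \<sigma>. ?A v * ?B v)"
      unfolding extensions_def eq using 3 by (intro sum.cong HOL.refl; simp)+
    note counts = this
    have in_\<sigma>: "a \<in> \<sigma>" "b \<in> \<sigma>" using 3 by auto
    show ?thesis
      unfolding counts sum_subtractf sum.distrib sum_distrib_left[symmetric] size
        one[OF in_\<sigma>(1)] one[OF in_\<sigma>(2)] two[OF in_\<sigma> 3(2)] card \<delta>_def
      by simp
  next
    case card: 4
    then obtain a b c where 4: "\<sigma> = {a, b, c}" "a \<noteq> b" "a \<noteq> c" "b \<noteq> c"
      by (metis card_3_iff)
    let ?A = "\<lambda>v. of_bool ({a, v} \<in> E) :: int"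
    let ?B = "\<lambda>v. of_bool ({b, v} \<in> E) :: int"
    let ?C = "\<lambda>v. of_bool ({c, v} \<in> E) :: int"
    let ?P = "\<lambda>v. ?A v * ?B v + ?A v * ?C v + ?B v * ?C v"
    have eq: "{u \<in> \<sigma>. {u, v} \<in> E} = (if {a, v} \<in> E then {a} else {})
        \<union> (if {b, v} \<in> E then {b} else {}) \<union> (if {c, v} \<in> E then {c} else {})" for v
      using 4 by auto
    have "\<not> ({a, v} \<in> E \<and> {b, v} \<in> E \<and> {c, v} \<in> E)" for v
      using no_common_neighbour_of_triangle[OF graph no4, of a b c] adj 4 by auto
    \<comment> \<open>At most two of \<open>a\<close>, \<open>b\<close>, \<open>c\<close> are
      adjacent to \<open>v\<close>, so \<open>?P v\<close> is 1 if there are exactly two and 0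
      otherwise; this makes the three polynomials exact indicators.\<close>
    then have "extensions V E \<sigma> 0 = (\<Sum>v\<in>V - \<sigma>. 1 - (?A v + ?B v + ?C v) + ?P v)"
      "extensions V E \<sigma> 1 = (\<Sum>v\<in>V - \<sigma>. ?A v + ?B v + ?C v - 2 * ?P v)"
      "extensions V E \<sigma> 2 = (\<Sum>v\<in>V - \<sigma>. ?P v)"
      unfolding extensions_def eq using 4 by (intro sum.cong HOL.refl; auto)+
    note counts = this
    have in_\<sigma>: "a \<in> \<sigma>" "b \<in> \<sigma>" "c \<in> \<sigma>" using 4 by auto
    show ?thesis
      unfolding counts sum_subtractf sum.distrib sum_distrib_left[symmetric] size
        one[OF in_\<sigma>(1)] one[OF in_\<sigma>(2)] one[OF in_\<sigma>(3)]
        two[OF in_\<sigma>(1,2) 4(2)] two[OF in_\<sigma>(1,3) 4(3)] two[OF in_\<sigma>(2,3) 4(4)] card \<delta>_def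
      by simp
  qed
  then show "extensions V E \<sigma> 0 = int n * \<delta> 0 + (int n - 1 - int l) * \<delta> 1
      + (int n - 2 * int l + int q) * \<delta> 2 + (int n - 3 * int l + 3 * int q) * \<delta> 3"
    and "extensions V E \<sigma> 1 = int l * \<delta> 1 + 2 * (int l - 1 - int q) * \<delta> 2 + 3 * (int l - 2 * int q) * \<delta> 3"
    and "extensions V E \<sigma> 2 = int q * \<delta> 2 + 3 * (int q - 1) * \<delta> 3"
    by blast+
qed

section \<open>The linear recurrence for the counts\<close>

lemma descent_count_0: "descent_count V E k 0 = of_bool (k = 0)"
proof -
  have "reduced_words V E 0 = {[]}" by (auto simp: reduced_words_def)
  then show ?thesis by (simp add: descent_count_def)
qed

lemma no_descents_iff: "descents E w = {} \<longleftrightarrow> w = []"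
  by (cases w) auto

text \<open>Only the empty word has no descents; this is the term 1 subtracted from the growth
  series.\<close>

lemma descent_count_no_descents: "descent_count V E 0 i = of_bool (i = 0)"
proof (cases "i = 0")
  case False
  then have "descents E w \<noteq> {}" if "w \<in> reduced_words V E i" for w
    using that by (auto simp: no_descents_iff reduced_words_def)
  then show ?thesis
    using False finite_descents by (auto simp: descent_count_def card_eq_0_iff intro!: sum.neutral)
qed (simp add: descent_count_0)

text \<open>Summing the formulas of \<open>extensions_descents\<close> over all reduced words of
  length \<open>i\<close> turns each indicator of size \<open>k\<close> into
  \<open>A k i\<close>.\<close>

lemma descent_count_recurrence:
  fixes A :: "nat \<Rightarrow> nat \<Rightarrow> int" and n l q :: nat
  assumes "finite V" "simplicial_graph V E" "card V = n"
    and "\<nexists>\<sigma>. clique V E \<sigma> \<and> card \<sigma> = 4" "regular_graph V E l"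
    and "\<forall>u v. {u, v} \<in> E \<longrightarrow> card (link V E {u, v}) = q"
  defines "A \<equiv> descent_count V E"
  shows "A 1 (Suc i) = int n * A 0 i + (int n - 1 - int l) * A 1 i
      + (int n - 2 * int l + int q) * A 2 i + (int n - 3 * int l + 3 * int q) * A 3 i"
    and "A 2 (Suc i) = int l * A 1 i + 2 * (int l - 1 - int q) * A 2 i + 3 * (int l - 2 * int q) * A 3 i"
    and "A 3 (Suc i) = int q * A 2 i + 3 * (int q - 1) * A 3 i"
    and "card (reduced_words V E i) = A 0 i + A 1 i + A 2 i + A 3 i"
proof -
  note extension_counts = extensions_descents[OF assms(1-6) clique_descents]
  have list: "w \<in> lists V" if "w \<in> reduced_words V E i" for w
    using that by (simp add: reduced_words_def)
  show "A 1 (Suc i) = int n * A 0 i + (int n - 1 - int l) * A 1 i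
      + (int n - 2 * int l + int q) * A 2 i + (int n - 3 * int l + 3 * int q) * A 3 i"
  proof -
    have "A 1 (Suc i) = (\<Sum>w\<in>reduced_words V E i. extensions V E (descents E w) 0)"
      unfolding A_def using descent_count_Suc[OF assms(1), of E 0] by simp
    also have "\<dots> = int n * A 0 i + (int n - 1 - int l) * A 1 i
      + (int n - 2 * int l + int q) * A 2 i + (int n - 3 * int l + 3 * int q) * A 3 i"
      unfolding A_def descent_count_def sum_distrib_left sum.distrib[symmetric]
      by (rule sum.cong[OF HOL.refl]) (rule extension_counts(1)[OF list])
    finally show ?thesis .
  qed
  show "A 2 (Suc i) = int l * A 1 i + 2 * (int l - 1 - int q) * A 2 i + 3 * (int l - 2 * int q) * A 3 i"
  proof -
    have "A 2 (Suc i) = (\<Sum>w\<in>reduced_words V E i. extensions V E (descents E w) 1)"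
      unfolding A_def using descent_count_Suc[OF assms(1), of E 1] by (simp add: numeral_2_eq_2)
    also have "\<dots> = int l * A 1 i + 2 * (int l - 1 - int q) * A 2 i + 3 * (int l - 2 * int q) * A 3 i"
      unfolding A_def descent_count_def sum_distrib_left sum.distrib[symmetric]
      by (rule sum.cong[OF HOL.refl]) (rule extension_counts(2)[OF list])
    finally show ?thesis .
  qed
  show "A 3 (Suc i) = int q * A 2 i + 3 * (int q - 1) * A 3 i"
  proof -
    have "A 3 (Suc i) = (\<Sum>w\<in>reduced_words V E i. extensions V E (descents E w) 2)"
      unfolding A_def using descent_count_Suc[OF assms(1), of E 2] by (simp add: numeral_3_eq_3)
    also have "\<dots> = int q * A 2 i + 3 * (int q - 1) * A 3 i"
      unfolding A_def descent_count_def sum_distrib_left sum.distrib[symmetric]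
      by (rule sum.cong[OF HOL.refl]) (rule extension_counts(3)[OF list])
    finally show ?thesis .
  qed
  have "int (card (reduced_words V E i)) = (\<Sum>w\<in>reduced_words V E i. 1)" by simp
  also have "\<dots> = A 0 i + A 1 i + A 2 i + A 3 i"
    unfolding A_def descent_count_def sum.distrib[symmetric]
  proof (rule sum.cong[OF HOL.refl])
    fix w assume "w \<in> reduced_words V E i"
    from extension_counts(4)[OF list[OF this]]
    show "1 = of_bool (card (descents E w) = 0) + of_bool (card (descents E w) = 1)
        + of_bool (card (descents E w) = 2) + (of_bool (card (descents E w) = 3) :: int)"
      by auto
  qed
  finally show "card (reduced_words V E i) = A 0 i + A 1 i + A 2 i + A 3 i" .
qed

text \<open>Cramer's rule: the multipliers of the three equations are the determinants of
  the coefficient matrix with one row replaced by ones.\<close>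

lemma transfer_system_solution:
  fixes z n l q a b c :: "'r :: comm_ring_1"
  assumes 1: "a = z * (n + (n - 1 - l) * a + (n - 2 * l + q) * b + (n - 3 * l + 3 * q) * c)"
    and 2: "b = z * (l * a + 2 * (l - 1 - q) * b + 3 * (l - 2 * q) * c)"
    and 3: "c = z * (q * b + 3 * (q - 1) * c)"
  shows "(a + b + c) * (1 + (6 - n - l - q) * z
         + (n * l + l * q + q * n - 5 * n - 3 * l - q + 11) * z ^ 2
         + (3 * n * l + 6 - n * l * q - 6 * n) * z ^ 3) =
      n * z * (1 + (5 - l - q) * z + (l * q - 3 * l + 6) * z ^ 2)"
proof -
  \<comment> \<open>Entries of the system with all unknowns moved to the left. There is no
    \<open>m31\<close>: one letter cannot take a descent set from size 1 to size 3.\<close>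
  define m11 m12 m13 where m1: "m11 = 1 - z * (n - 1 - l)" "m12 = - z * (n - 2 * l + q)"
    "m13 = - z * (n - 3 * l + 3 * q)"
  define m21 m22 m23 where m2: "m21 = - z * l" "m22 = 1 - z * 2 * (l - 1 - q)"
    "m23 = - z * 3 * (l - 2 * q)"
  define m32 m33 where m3: "m32 = - z * q" "m33 = 1 - z * 3 * (q - 1)"
  define d where "d = m11 * (m22 * m33 - m23 * m32) - m21 * (m12 * m33 - m13 * m32)"
  define c1 where "c1 = m22 * m33 - m23 * m32 - m21 * m33 + m21 * m32"
  define c2 where "c2 = m11 * (m33 - m32) - m12 * m33 + m13 * m32"
  define c3 where "c3 = m11 * (m22 - m23) - m12 * (m21 - m23) + m13 * (m21 - m22)"
  have "m11 * a + m12 * b + m13 * c = n * z"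
    using 1 unfolding m1 by (simp add: algebra_simps)
  moreover have "m21 * a + m22 * b + m23 * c = 0"
    using 2 unfolding m2 by (simp add: algebra_simps)
  moreover have "m32 * b + m33 * c = 0"
    using 3 unfolding m3 by (simp add: algebra_simps)
  moreover have "(a + b + c) * d = c1 * (m11 * a + m12 * b + m13 * c)
      + c2 * (m21 * a + m22 * b + m23 * c) + c3 * (m32 * b + m33 * c)"
    unfolding d_def c1_def c2_def c3_def by (simp add: algebra_simps)
  \<comment> \<open>Only the first equation has a nonzero right-hand side, so only \<open>c1\<close>
    survives.\<close>
  ultimately have "(a + b + c) * d = c1 * (n * z)" by simp
  moreover have "c1 = 1 + (5 - l - q) * z + (l * q - 3 * l + 6) * z ^ 2"
    unfolding c1_def m1 m2 m3
    by (simp add: algebra_simps power2_eq_square power3_eq_cube)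
  moreover have "d = 1 + (6 - n - l - q) * z
         + (n * l + l * q + q * n - 5 * n - 3 * l - q + 11) * z ^ 2
         + (3 * n * l + 6 - n * l * q - 6 * n) * z ^ 3"
    unfolding d_def m1 m2 m3
    by (simp add: algebra_simps power2_eq_square power3_eq_cube)
  ultimately show ?thesis by (simp add: mult.commute)
qed

theorem theorem1p1:
  fixes V :: "'a set" and E :: "'a set set" and n l q :: nat
  assumes "finite V" and "simplicial_graph V E" and "card V = n"
    and "link_regular V E"
    and "\<nexists>\<sigma>. clique V E \<sigma> \<and> card \<sigma> = 4"
    and "regular_graph V E l"
    and "\<And>u v. {u, v} \<in> E \<Longrightarrow> card (link V E {u, v}) = q"
  shows "rat_fps (geodesic_growth_series (racg V E) (racg_gens V E) - 1) =
    (let z = fps_X; n = of_nat n; l = of_nat l; q = of_nat q in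
      (n * z * (1 + (5 - l - q) * z + (l * q - 3 * l + 6) * z ^ 2)) /
      (1 + (6 - n - l - q) * z
         + (n * l + l * q + q * n - 5 * n - 3 * l - q + 11) * z ^ 2
         + (3 * n * l + 6 - n * l * q - 6 * n) * z ^ 3))"
proof -
  define A where "A k = Abs_fps (\<lambda>i. rat_of_int (descent_count V E k i))" for k
  have "\<forall>u v. {u, v} \<in> E \<longrightarrow> card (link V E {u, v}) = q"
    using assms(7) by blast
  note rec = descent_count_recurrence[OF assms(1-3,5-6) this]
  have const: "of_int m = fps_const (rat_of_int m)" for m
    by (simp add: fps_of_int)
  have nat: "of_nat m = (of_int (int m) :: rat fps)" for m by simp
  have A0: "A 0 = 1"
    by (rule fps_ext) (simp add: A_def descent_count_no_descents)
  \<comment> \<open>For \<open>k\<close> nonzero the constant coefficient vanishes, so a recurrence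
    from \<open>i\<close> to \<open>Suc i\<close> becomes multiplication by the variable.\<close>
  have shift: "A k = fps_X * B"
    if "k \<noteq> 0" "\<And>i. rat_of_int (descent_count V E k (Suc i)) = fps_nth B i" for k B
  proof (rule fps_ext)
    fix i
    show "fps_nth (A k) i = fps_nth (fps_X * B) i"
      using that by (cases i) (simp_all add: A_def descent_count_0)
  qed
  have "A 1 = fps_X * (of_int n * A 0 + of_int (int n - 1 - l) * A 1
      + of_int (int n - 2 * l + q) * A 2 + of_int (int n - 3 * l + 3 * q) * A 3)"
    by (rule shift) (simp_all only: rec(1) const, simp_all add: A_def)
  then have 1: "A 1 = fps_X * (of_nat n + (of_nat n - 1 - of_nat l) * A 1
      + (of_nat n - 2 * of_nat l + of_nat q) * A 2 + (of_nat n - 3 * of_nat l + 3 * of_nat q) * A 3)"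
    by (simp add: A0)
  have "A 2 = fps_X * (of_int l * A 1 + of_int (2 * (int l - 1 - q)) * A 2
      + of_int (3 * (int l - 2 * q)) * A 3)"
    by (rule shift) (simp_all only: rec(2) const, simp_all add: A_def)
  then have 2: "A 2 = fps_X * (of_nat l * A 1 + 2 * (of_nat l - 1 - of_nat q) * A 2
      + 3 * (of_nat l - 2 * of_nat q) * A 3)"
    by simp
  have "A 3 = fps_X * (of_int q * A 2 + of_int (3 * (int q - 1)) * A 3)"
    by (rule shift) (simp_all only: rec(3) const, simp_all add: A_def)
  then have 3: "A 3 = fps_X * (of_nat q * A 2 + 3 * (of_nat q - 1) * A 3)"
    by simp
  have "rat_fps (geodesic_growth_series (racg V E) (racg_gens V E) - 1) = A 1 + A 2 + A 3"
    by (rule fps_ext) (simp add: rat_fps_def geodesic_growth_series_def A_def rec(4)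
        card_geodesics descent_count_no_descents)
  \<comment> \<open>The denominator has constant term 1, hence is nonzero and can be cancelled after
    the numerator is rewritten as a product with it.\<close>
  moreover have "fps_nth (1 + u * fps_X + v * fps_X ^ 2 + w * fps_X ^ 3 :: rat fps) 0 \<noteq> 0"
    for u v w by simp
  then have "1 + u * fps_X + v * fps_X ^ 2 + w * fps_X ^ 3 \<noteq> (0 :: rat fps)" for u v w
    by (metis fps_zero_nth)
  ultimately show ?thesis
    unfolding Let_def transfer_system_solution[OF 1 2 3, symmetric] by simp
qed

end
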